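(* For every natural number $d$ with $2\le d\le n$, the connected components (connectivity) problem on undirected $n$-node graphs can be solved deterministically in the broadcast congested clique with bandwidth $d\log n$ in $O(\log_d n)$ rounds, such that each node transmits $O\left(\log n\left(d+\frac{\log n}{\log d}\right)\right)$ bits in total during the whole execution. The constants hidden in $O(\cdot)$ do not depend on $n$ and $d$.
   Context: Model. $n$ nodes with unique IDs in $[n]=\{1,\dots,n\}$ form a fully connected synchronous network. In each round of the broadcast congested clique with bandwidth $b$, every node sends one message of at most $b$ bits (up to a constant factor), the same to all other nodes; local computation is free. The number of bits transmitted by a node is the sum over all rounds of the lengths of the messages it broadcasts (a broadcast message is counted once per round). Input. The input is an undirected $n$-node graph $G$ whose nodes are identified with the nodes of the network. Each node initially knows $n$, its own ID and the IDs of its neighbors in $G$. Problem. At the end of the execution every node must know a set of edges of $G$ inducing the connected components of $G$ (a spanning forest). *)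

theory Defs
  imports Complex_Main
begin

section \<open>Undirected graphs\<close>

text \<open>A simple undirected graph is given by its vertex set and a set of two-element edges.\<close>

definition ugraph :: "nat set \<Rightarrow> nat set set \<Rightarrow> bool" where
  "ugraph V E \<longleftrightarrow> (\<forall>e\<in>E. e \<subseteq> V \<and> card e = 2)"

definition adj_rel :: "nat set set \<Rightarrow> (nat \<times> nat) set" where
  "adj_rel E = {(u, v). {u, v} \<in> E}"

definition neighbors :: "nat set set \<Rightarrow> nat \<Rightarrow> nat set" where
  "neighbors E v = {u. {u, v} \<in> E}"

definition components :: "nat set \<Rightarrow> nat set set \<Rightarrow> nat set set" where
  "components V E = V // {(u, v). u \<in> V \<and> v \<in> V \<and> (u, v) \<in> (adj_rel E)\<^sup>*}"

definition is_cycle :: "nat set set \<Rightarrow> nat list \<Rightarrow> bool" where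
  "is_cycle E vs \<longleftrightarrow> 3 \<le> length vs \<and> distinct vs \<and>
     (\<forall>i<length vs. {vs ! i, vs ! (Suc i mod length vs)} \<in> E)"

definition spanning_forest :: "nat set \<Rightarrow> nat set set \<Rightarrow> nat set set \<Rightarrow> bool" where
  "spanning_forest V E F \<longleftrightarrow>
     F \<subseteq> E \<and> (\<nexists>vs. is_cycle F vs) \<and> components V F = components V E"


section \<open>The broadcast congested clique\<close>

type_synonym message = "bool list"

text \<open>A transcript lists, round by round, the message broadcast by each node.\<close>

type_synonym transcript = "(nat \<Rightarrow> message) list"

text \<open>
  A deterministic algorithm determines what a node broadcasts next, and what it outputs at the
  end, from all that the node knows: its ID, the IDs of its neighbors and the transcript of the
  completed rounds. Local computation is free, so arbitrary functions are allowed. An algorithm is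
  meant for one network size, which is how every node knows \<open>n\<close>.
\<close>

record bcc_algorithm =
  send :: "nat \<Rightarrow> nat set \<Rightarrow> transcript \<Rightarrow> message"
  result :: "nat \<Rightarrow> nat set \<Rightarrow> transcript \<Rightarrow> nat set set"

text \<open>There are no nodes outside \<open>{1..n}\<close>; their transcript entries are the dummy value \<open>[]\<close>.\<close>

primrec transcript :: "bcc_algorithm \<Rightarrow> nat \<Rightarrow> nat set set \<Rightarrow> nat \<Rightarrow> transcript" where
  "transcript A n E 0 = []"
| "transcript A n E (Suc t) = transcript A n E t @
     [\<lambda>v. if v \<in> {1..n} then send A v (neighbors E v) (transcript A n E t) else []]"

definition message_length :: "bcc_algorithm \<Rightarrow> nat \<Rightarrow> nat set set \<Rightarrow> nat \<Rightarrow> nat \<Rightarrow> nat" where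
  "message_length A n E t v = length (send A v (neighbors E v) (transcript A n E t))"

text \<open>
  \<open>connectivity_solvable n b r s\<close>: some deterministic algorithm solves connectivity on all
  graphs with node set \<open>{1..n}\<close> in at most \<open>r\<close> rounds, with messages of at most \<open>b\<close> bits,
  every node transmitting at most \<open>s\<close> bits altogether. An execution that ends earlier on some
  graphs is padded with empty messages to the common number \<open>T\<close> of rounds.
\<close>

definition connectivity_solvable :: "nat \<Rightarrow> real \<Rightarrow> real \<Rightarrow> real \<Rightarrow> bool" where
  "connectivity_solvable n b r s \<longleftrightarrow>
     (\<exists>A T. real T \<le> r \<and>
        (\<forall>E. ugraph {1..n} E \<longrightarrow>
          (\<forall>v\<in>{1..n}.
             (\<forall>t<T. real (message_length A n E t v) \<le> b) \<and>
             real (\<Sum>t<T. message_length A n E t v) \<le> s \<and>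
             spanning_forest {1..n} E (result A v (neighbors E v) (transcript A n E T)))))"

end

theory Submission
  imports Defs "HOL-Library.Log_Nat"
begin

text \<open>
  The algorithm works in phases of three rounds. Call two nodes connected if the edges announced so
  far connect them, and let the degree of a node be the number of components, other than its own,
  in which it has neighbours. In a phase, every node first broadcasts its degree. A node of degree
  less than \<open>d\<close> then announces an edge to each of these components; from then on its degree is 0,
  so it pays for this only once. A node of degree at least \<open>d\<close> announces an edge to the best
  adjacent component, components being ranked by the largest degree of their nodes, and in the third
  round an edge to a neighbour whose own announcement reached the best component.

  Let \<open>l\<close> be the top-ranked node of a merged component. If \<open>l\<close> has degree less than \<open>d\<close>, then so has
  every node there, so all edges leaving the old components have been bridged and the merged
  component is a connected component of the graph. Otherwise no neighbour of \<open>l\<close> can have announced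
  an edge to a component better than that of \<open>l\<close>, as the third-round edge of \<open>l\<close> would have brought
  such a component in; hence all of the at least \<open>d\<close> components adjacent to \<open>l\<close> were merged.
  Inductively, after \<open>p\<close> phases every component is finished or has at least \<open>d ^ p\<close> nodes.
\<close>

section \<open>Components and spanning forests\<close>

text \<open>No vertex set occurs here, so \<open>components\<close> can be compared node by node,
  and a number that no edge touches forms a class of its own.\<close>

definition cls :: "nat set set \<Rightarrow> nat \<Rightarrow> nat set" where
  "cls K v = (adj_rel K)\<^sup>* `` {v}"

lemma adj_rel_iff: "(u, v) \<in> adj_rel K \<longleftrightarrow> {u, v} \<in> K"
  by (simp add: adj_rel_def)

lemma sym_adj_rel: "sym (adj_rel K)"
  by (auto simp: sym_def adj_rel_def insert_commute)

lemma cls_refl [simp]: "v \<in> cls K v"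
  by (simp add: cls_def)

lemma cls_eq_iff: "cls K u = cls K v \<longleftrightarrow> u \<in> cls K v"
proof
  assume "u \<in> cls K v"
  then have *: "(v, u) \<in> (adj_rel K)\<^sup>*" by (simp add: cls_def)
  then have "(u, v) \<in> (adj_rel K)\<^sup>*"
    using sym_rtrancl[OF sym_adj_rel] by (meson symD)
  with * show "cls K u = cls K v"
    by (auto simp: cls_def intro: rtrancl_trans)
qed (use cls_refl in blast)

lemma cls_edge: "{u, v} \<in> K \<Longrightarrow> v \<in> cls K u"
  by (auto simp: cls_def adj_rel_iff)

lemma cls_step: "{u, v} \<in> K \<Longrightarrow> u \<in> cls K w \<Longrightarrow> v \<in> cls K w"
  using cls_edge cls_eq_iff by blast

lemma adj_rel_mono: "K \<subseteq> L \<Longrightarrow> adj_rel K \<subseteq> adj_rel L"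
  by (auto simp: adj_rel_def)

lemma cls_mono: "K \<subseteq> L \<Longrightarrow> cls K v \<subseteq> cls L v"
  unfolding cls_def by (intro Image_mono rtrancl_mono adj_rel_mono subset_refl)

lemma cls_subset_closed:
  assumes "v \<in> S" and "\<And>x y. x \<in> S \<Longrightarrow> {x, y} \<in> K \<Longrightarrow> y \<in> S"
  shows "cls K v \<subseteq> S"
proof -
  have "y \<in> S" if "(v, y) \<in> (adj_rel K)\<^sup>*" for y
    using that by (induction rule: rtrancl_induct) (use assms in \<open>auto simp: adj_rel_iff\<close>)
  then show ?thesis by (auto simp: cls_def)
qed

lemma components_cong:
  assumes "\<And>v. v \<in> V \<Longrightarrow> cls K v = cls L v"
  shows "components V K = components V L"
proof -
  have "{(u, v). u \<in> V \<and> v \<in> V \<and> (u, v) \<in> (adj_rel K)\<^sup>*} =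
        {(u, v). u \<in> V \<and> v \<in> V \<and> (u, v) \<in> (adj_rel L)\<^sup>*}"
    using assms by (auto simp: cls_def)
  then show ?thesis by (simp add: components_def)
qed

text \<open>The rest of a cycle still joins the two ends of its closing edge, so removing that edge
  separates nothing.\<close>

lemma cls_delete_cycle_edge:
  assumes "is_cycle F vs"
  shows "\<exists>e\<in>F. \<forall>v. cls (F - {e}) v = cls F v"
proof -
  define l where "l = length vs - 1"
  have l: "2 \<le> l" "length vs = Suc l" and dist: "distinct vs"
    and edges: "\<And>i. i \<le> l \<Longrightarrow> {vs ! i, vs ! (Suc i mod Suc l)} \<in> F"
  proof -
    have "3 \<le> length vs" using assms by (simp add: is_cycle_def)
    then show len: "2 \<le> l" "length vs = Suc l" by (simp_all add: l_def)
    show "distinct vs" using assms by (simp add: is_cycle_def)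
    show "{vs ! i, vs ! (Suc i mod Suc l)} \<in> F" if "i \<le> l" for i
      using assms len(2) that by (simp add: is_cycle_def)
  qed
  define e where "e = {vs ! l, vs ! 0}"
  have e: "e \<in> F" using edges[of l] by (simp add: e_def)
  have path: "vs ! i \<in> cls (F - {e}) (vs ! 0)" if "i \<le> l" for i
    using that
  proof (induction i)
    case (Suc i)
    have "{vs ! i, vs ! Suc i} \<in> F" using edges[of i] Suc.prems by simp
    \<comment> \<open>By distinctness, equality would force \<open>i = 0\<close> and
      \<open>Suc i = l\<close>, against \<open>2 \<le> l\<close>.\<close>
    moreover have "{vs ! i, vs ! Suc i} \<noteq> e"
      using Suc.prems l dist by (auto simp: e_def doubleton_eq_iff nth_eq_iff_index_eq)
    ultimately show ?case
      using Suc.IH Suc.prems cls_step by (metis DiffI Suc_leD singletonD)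
  qed simp
  then have end_in: "vs ! l \<in> cls (F - {e}) (vs ! 0)" by simp
  have "cls F v \<subseteq> cls (F - {e}) v" for v
  proof (rule cls_subset_closed)
    fix x y assume x: "x \<in> cls (F - {e}) v" and xy: "{x, y} \<in> F"
    show "y \<in> cls (F - {e}) v"
    proof (cases "{x, y} = e")
      case True
      then have "cls (F - {e}) x = cls (F - {e}) y"
        using end_in by (auto simp: e_def doubleton_eq_iff cls_eq_iff) (use cls_eq_iff in blast)
      then show ?thesis using x cls_eq_iff by metis
    qed (use x xy cls_step in \<open>metis DiffI singletonD\<close>)
  qed simp
  then have "cls (F - {e}) v = cls F v" for v
    using cls_mono[of "F - {e}" F v] by blast
  with e show ?thesis by blast
qed

lemma exists_forest:
  assumes "finite K"
  shows "\<exists>F\<subseteq>K. (\<nexists>vs. is_cycle F vs) \<and> (\<forall>v. cls F v = cls K v)"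
  using assms
proof (induction "card K" arbitrary: K rule: less_induct)
  case less
  show ?case
  proof (cases "\<exists>vs. is_cycle K vs")
    case True
    then obtain e where e: "e \<in> K" "\<And>v. cls (K - {e}) v = cls K v"
      using cls_delete_cycle_edge by blast
    have "card (K - {e}) < card K" using e(1) less.prems by (meson card_Diff1_less)
    then obtain F where "F \<subseteq> K - {e}" "\<nexists>vs. is_cycle F vs" "\<forall>v. cls F v = cls (K - {e}) v"
      using less.hyps[of "K - {e}"] less.prems by (meson finite_Diff)
    then show ?thesis by (intro exI[of _ F]) (auto simp: e(2))
  qed blast
qed

section \<open>Messages made of numbers\<close>

text \<open>Each number becomes a block of exactly \<open>k\<close> bits, so a concatenation splits
  uniquely. Fixing \<open>dec [] = []\<close> lets the dummy transcript entries survive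
  decoding.\<close>

lemma block_code_exists:
  assumes "0 < k"
  shows "\<exists>(enc :: nat list \<Rightarrow> bool list) dec.
    (\<forall>xs. length (enc xs) = k * length xs) \<and> dec [] = [] \<and>
    (\<forall>xs. set xs \<subseteq> {..<2 ^ k} \<longrightarrow> dec (enc xs) = xs)"
proof -
  have card: "card {xs :: bool list. length xs = k} = 2 ^ k"
    using card_lists_length_eq[of "UNIV :: bool set" k] by simp
  moreover have "finite {xs :: bool list. length xs = k}"
    using card by (intro card_ge_0_finite) simp
  ultimately obtain f where f: "bij_betw f {..<2 ^ k :: nat} {xs :: bool list. length xs = k}"
    using finite_same_card_bij[of "{..<2 ^ k :: nat}" "{xs :: bool list. length xs = k}"]
    by (metis card_lessThan finite_lessThan)
  \<comment> \<open>The default block for numbers out of range keeps the length law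
    unconditional.\<close>
  define c where "c x = (if x < 2 ^ k then f x else replicate k False)" for x :: nat
  have len: "length (c x) = k" for x
    using f by (auto simp: c_def bij_betw_def)
  have inj: "inj_on c {..<2 ^ k}"
    using f by (auto simp: c_def bij_betw_def inj_on_def)
  define enc where "enc xs = concat (map c xs)" for xs
  have len_enc: "length (enc xs) = k * length xs" for xs
    by (induction xs) (auto simp: enc_def len)
  have "inj_on enc {xs. set xs \<subseteq> {..<2 ^ k}}"
  proof (rule inj_onI)
    fix xs ys assume A: "xs \<in> {xs. set xs \<subseteq> {..<2 ^ k}}" "ys \<in> {xs. set xs \<subseteq> {..<2 ^ k}}"
      and eq: "enc xs = enc ys"
    then have "length xs = length ys" using len_enc assms by (metis nat_mult_eq_cancel1)
    then have "map c xs = map c ys"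
      using eq by (intro concat_injective) (auto simp: enc_def len dest: set_zip_leftD set_zip_rightD
        simp: zip_map_map)
    moreover have "inj_on c (set xs \<union> set ys)"
      using A by (intro inj_on_subset[OF inj]) auto
    ultimately show "xs = ys" by (rule map_inj_on)
  qed
  then have dec: "inv_into {xs. set xs \<subseteq> {..<2 ^ k}} enc (enc xs) = xs" if "set xs \<subseteq> {..<2 ^ k}" for xs
    using that by simp
  moreover from dec[of "[]"] have "inv_into {xs. set xs \<subseteq> {..<2 ^ k}} enc [] = []"
    by (simp add: enc_def)
  ultimately show ?thesis using len_enc by blast
qed

type_synonym num_transcript = "(nat \<Rightarrow> nat list) list"

primrec run :: "(nat \<Rightarrow> nat set \<Rightarrow> num_transcript \<Rightarrow> nat list) \<Rightarrow> nat \<Rightarrow> nat set set \<Rightarrow> nat \<Rightarrow> num_transcript"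
  where
  "run f n E 0 = []"
| "run f n E (Suc t) = run f n E t @
     [\<lambda>v. if v \<in> {1..n} then f v (neighbors E v) (run f n E t) else []]"

lemma length_run [simp]: "length (run f n E t) = t"
  by (induction t) auto

text \<open>Reduces the task to algorithms that broadcast lists of numbers up to \<open>n\<close>:
  nodes decode the transcript, apply \<open>f\<close> and encode the answer, at a price of
  \<open>k\<close> bits per number.\<close>

lemma connectivity_solvable_run:
  assumes n: "n < 2 ^ k" "0 < k"
    and r: "real T \<le> r"
    and vals: "\<And>E v t. ugraph {1..n} E \<Longrightarrow> v \<in> {1..n} \<Longrightarrow> t < T \<Longrightarrow>
      set (f v (neighbors E v) (run f n E t)) \<subseteq> {..n}"
    and len: "\<And>E v t. ugraph {1..n} E \<Longrightarrow> v \<in> {1..n} \<Longrightarrow> t < T \<Longrightarrow>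
      length (f v (neighbors E v) (run f n E t)) \<le> L"
    and total: "\<And>E v. ugraph {1..n} E \<Longrightarrow> v \<in> {1..n} \<Longrightarrow>
      (\<Sum>t<T. length (f v (neighbors E v) (run f n E t))) \<le> S"
    and res: "\<And>E v. ugraph {1..n} E \<Longrightarrow> v \<in> {1..n} \<Longrightarrow>
      spanning_forest {1..n} E (g (run f n E T))"
    and b: "real (k * L) \<le> b" and s: "real (k * S) \<le> s"
  shows "connectivity_solvable n b r s"
proof -
  obtain enc :: "nat list \<Rightarrow> bool list" and dec where lenc: "\<And>xs. length (enc xs) = k * length xs"
    and dec0: "dec [] = []" and dec: "\<And>xs. set xs \<subseteq> {..<2 ^ k} \<Longrightarrow> dec (enc xs) = xs"
    using block_code_exists[OF n(2)] by blast
  define decs where "decs = map (\<lambda>m :: nat \<Rightarrow> message. dec \<circ> m)"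
  define A where "A = \<lparr>send = \<lambda>v N \<tau>. enc (f v N (decs \<tau>)), result = \<lambda>v N \<tau>. g (decs \<tau>)\<rparr>"
  have sim: "decs (transcript A n E t) = run f n E t" if E: "ugraph {1..n} E" and "t \<le> T" for E t
    using that(2)
  proof (induction t)
    case (Suc t)
    have "set (f v (neighbors E v) (run f n E t)) \<subseteq> {..<2 ^ k}" if "v \<in> {1..n}" for v
      using vals[OF E that, of t] n(1) Suc.prems by fastforce
    then have "dec (enc (f v (neighbors E v) (run f n E t))) = f v (neighbors E v) (run f n E t)"
      if "v \<in> {1..n}" for v
      using dec that by blast
    with Suc show ?case
      by (auto simp: decs_def A_def dec0 fun_eq_iff)
  qed (simp add: decs_def)
  have ml: "message_length A n E t v = k * length (f v (neighbors E v) (run f n E t))"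
    if "ugraph {1..n} E" "t < T" for E t v
    using sim[of E t] that by (simp add: message_length_def A_def lenc)
  show ?thesis
    unfolding connectivity_solvable_def
  proof (intro exI conjI allI impI ballI)
    fix E v t assume E: "ugraph {1..n} E" and v: "v \<in> {1..n}" and t: "t < T"
    have "message_length A n E t v \<le> k * L"
      using ml[OF E t] len[OF E v t] by simp
    then show "real (message_length A n E t v) \<le> b" using b by linarith
  next
    fix E v assume E: "ugraph {1..n} E" and v: "v \<in> {1..n}"
    have "(\<Sum>t<T. message_length A n E t v) = k * (\<Sum>t<T. length (f v (neighbors E v) (run f n E t)))"
      unfolding sum_distrib_left by (intro sum.cong) (auto simp: ml[OF E])
    also have "\<dots> \<le> k * S" using total[OF E v] by simp
    finally show "real (\<Sum>t<T. message_length A n E t v) \<le> s" using s by linarith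
    show "spanning_forest {1..n} E (result A v (neighbors E v) (transcript A n E T))"
      using res[OF E v] sim[OF E order_refl] by (simp add: A_def)
  qed (rule r)
qed

section \<open>The algorithm\<close>

definition outer :: "nat set set \<Rightarrow> nat set \<Rightarrow> nat \<Rightarrow> nat set" where
  "outer K N v = {w \<in> N. cls K w \<noteq> cls K v}"

definition deg :: "nat set set \<Rightarrow> nat set \<Rightarrow> nat \<Rightarrow> nat" where
  "deg K N v = card (cls K ` outer K N v)"

text \<open>One neighbour for each adjacent component. Any choice will do, because only the sender
  makes it and all others see the result.\<close>

definition reps :: "nat set set \<Rightarrow> nat set \<Rightarrow> nat \<Rightarrow> nat list" where
  "reps K N v = (SOME xs. set xs \<subseteq> outer K N v \<and> cls K ` set xs = cls K ` outer K N v \<and>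
     length xs = deg K N v)"

text \<open>The second summand breaks ties: distinct nodes of \<open>{1..n}\<close> have distinct priorities, so distinct
  components have distinct keys. Without this, mutually tied components could block the merging.\<close>

definition prio :: "nat \<Rightarrow> (nat \<Rightarrow> nat) \<Rightarrow> nat \<Rightarrow> nat" where
  "prio n D v = D v * (n + 1) + v"

definition key :: "nat \<Rightarrow> nat set set \<Rightarrow> (nat \<Rightarrow> nat) \<Rightarrow> nat \<Rightarrow> nat" where
  "key n K D v = Max (prio n D ` cls K v)"

definition msg1 :: "nat \<Rightarrow> nat \<Rightarrow> nat set set \<Rightarrow> (nat \<Rightarrow> nat) \<Rightarrow> nat set \<Rightarrow> nat \<Rightarrow> nat list" where
  "msg1 n d K D N v =
     (if D v < d then reps K N v else [arg_max (key n K D) (\<lambda>w. w \<in> outer K N v)])"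

text \<open>The best component that \<open>w\<close> announced an edge to. The scores compared in
  \<open>msg2\<close> belong to nodes with a neighbour in another component; these announce
  something, so the maximum is over a nonempty set.\<close>

definition score :: "nat \<Rightarrow> nat set set \<Rightarrow> (nat \<Rightarrow> nat) \<Rightarrow> (nat \<Rightarrow> nat list) \<Rightarrow> nat \<Rightarrow> nat" where
  "score n K D M w = Max (key n K D ` set (M w))"

definition msg2 ::
  "nat \<Rightarrow> nat \<Rightarrow> nat set set \<Rightarrow> (nat \<Rightarrow> nat) \<Rightarrow> (nat \<Rightarrow> nat list) \<Rightarrow> nat set \<Rightarrow> nat \<Rightarrow> nat list" where
  "msg2 n d K D M N v =
     (if D v < d then [] else [arg_max (score n K D M) (\<lambda>w. w \<in> outer K N v)])"

definition announced :: "(nat \<Rightarrow> nat list) \<Rightarrow> nat set set" where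
  "announced m = {{v, w} |v w. w \<in> set (m v)}"

text \<open>The rounds divisible by 3 are skipped: the numbers sent there are degrees.\<close>

definition known :: "num_transcript \<Rightarrow> nat set set" where
  "known \<tau> = (\<Union>i\<in>{i. i < length \<tau> \<and> i mod 3 \<noteq> 0}. announced (\<tau> ! i))"

text \<open>\<open>K\<close> is frozen at the start \<open>p\<close> of the current phase, so all
  nodes work with the same components. \<open>sum_list\<close> reads the degree off a one-element
  message and turns the dummy \<open>[]\<close> into 0.\<close>

definition conn_send :: "nat \<Rightarrow> nat \<Rightarrow> nat \<Rightarrow> nat set \<Rightarrow> num_transcript \<Rightarrow> nat list" where
  "conn_send n d v N \<tau> =
     (let p = 3 * (length \<tau> div 3); K = known (take p \<tau>); D = (\<lambda>u. sum_list ((\<tau> ! p) u)) in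
      if length \<tau> mod 3 = 0 then [deg K N v]
      else if length \<tau> mod 3 = 1 then msg1 n d K D N v
      else msg2 n d K D (\<tau> ! (p + 1)) N v)"

text \<open>A function of the transcript alone, hence the same forest at every node.\<close>

definition conn_result :: "num_transcript \<Rightarrow> nat set set" where
  "conn_result \<tau> =
     (SOME F. F \<subseteq> known \<tau> \<and> (\<nexists>vs. is_cycle F vs) \<and> (\<forall>v. cls F v = cls (known \<tau>) v))"

section \<open>Announcements within one phase\<close>

lemma reps:
  assumes "finite N"
  shows "set (reps K N v) \<subseteq> outer K N v" "cls K ` set (reps K N v) = cls K ` outer K N v"
    "length (reps K N v) = deg K N v"
proof -
  have fin: "finite (outer K N v)" using assms by (simp add: outer_def)
  obtain B where B: "B \<subseteq> outer K N v" "inj_on (cls K) B" "cls K ` B = cls K ` outer K N v"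
    using subset_image_inj[of "cls K ` outer K N v" "cls K" "outer K N v"] by auto
  moreover obtain xs where xs: "set xs = B" "distinct xs"
    using finite_distinct_list[OF finite_subset[OF B(1) fin]] by blast
  moreover from this B have "length xs = deg K N v"
    by (metis deg_def card_image distinct_card)
  ultimately have "\<exists>xs. set xs \<subseteq> outer K N v \<and> cls K ` set xs = cls K ` outer K N v \<and>
     length xs = deg K N v" by blast
  from someI_ex[OF this]
  show "set (reps K N v) \<subseteq> outer K N v" "cls K ` set (reps K N v) = cls K ` outer K N v"
    "length (reps K N v) = deg K N v" by (auto simp: reps_def)
qed

lemma arg_max_finite:
  fixes f :: "nat \<Rightarrow> nat"
  assumes "finite S" "x \<in> S"
  shows "arg_max f (\<lambda>w. w \<in> S) \<in> S" "f x \<le> f (arg_max f (\<lambda>w. w \<in> S))"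
proof -
  have "\<forall>y. y \<in> S \<longrightarrow> f y < Suc (Max (f ` S))" using assms by (simp add: less_Suc_eq_le)
  from arg_max_nat_lemma[of "\<lambda>w. w \<in> S", OF assms(2) this]
  show "arg_max f (\<lambda>w. w \<in> S) \<in> S" "f x \<le> f (arg_max f (\<lambda>w. w \<in> S))"
    using assms(2) by auto
qed

section \<open>One phase as an operation on edge sets\<close>

locale clique_graph =
  fixes n d :: nat and E :: "nat set set"
  assumes d: "2 \<le> d" and graph: "ugraph {1..n} E"
begin

abbreviation "V \<equiv> {1..n}"
abbreviation "N \<equiv> neighbors E"

text \<open>A phase described from the graph and the current edge set, without transcripts;
  \<open>run_phase_step\<close> shows that the execution sends these messages.\<close>

definition D where "D K v = deg K (N v) v"
definition M1 where "M1 K v = msg1 n d K (D K) (N v) v"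
definition M2 where "M2 K v = msg2 n d K (D K) (M1 K) (N v) v"
definition step where "step K = K \<union> announced (M1 K) \<union> announced (M2 K)"
definition phase_edges where "phase_edges p = (step ^^ p) {}"

lemma edge_V: "{u, v} \<in> E \<Longrightarrow> u \<in> V \<and> v \<in> V"
  using graph by (auto simp: ugraph_def)

lemma finite_E: "finite E"
  by (rule finite_subset[of _ "Pow V"]) (use graph in \<open>auto simp: ugraph_def\<close>)

lemma N_iff: "w \<in> N v \<longleftrightarrow> {v, w} \<in> E"
  by (simp add: neighbors_def insert_commute)

lemma N_subset: "N v \<subseteq> V"
  using edge_V by (auto simp: N_iff)

lemma finite_N: "finite (N v)"
  using N_subset finite_subset by blast

lemma finite_outer: "finite (outer K (N v) v)"
  using finite_N by (simp add: outer_def)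

lemma outer_subset: "outer K (N v) v \<subseteq> N v"
  by (auto simp: outer_def)

lemma outer_sym: "w \<in> outer K (N v) v \<Longrightarrow> v \<in> outer K (N w) w"
  by (auto simp: outer_def N_iff insert_commute)

lemma D_le: "D K v \<le> n"
proof -
  have "D K v \<le> card (N v)"
    unfolding D_def deg_def
    using card_image_le[OF finite_outer] card_mono[OF finite_N outer_subset] le_trans by blast
  also have "\<dots> \<le> card V" using N_subset by (intro card_mono) auto
  finally show ?thesis by simp
qed

lemma D_pos_iff: "0 < D K v \<longleftrightarrow> outer K (N v) v \<noteq> {}"
  unfolding D_def deg_def using finite_outer by (simp add: card_gt_0_iff)

lemma D_outside: "v \<notin> V \<Longrightarrow> D K v = 0"
  using edge_V D_pos_iff[of K v] by (auto simp: outer_def N_iff)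

lemma M1_subset: "set (M1 K v) \<subseteq> outer K (N v) v"
proof (cases "D K v < d")
  case False
  then have "outer K (N v) v \<noteq> {}" using d D_pos_iff[of K v] by linarith
  then show ?thesis using arg_max_finite[OF finite_outer] False by (auto simp: M1_def msg1_def)
qed (use reps(1)[OF finite_N] in \<open>auto simp: M1_def msg1_def\<close>)

lemma M2_subset: "set (M2 K v) \<subseteq> outer K (N v) v"
proof (cases "D K v < d")
  case False
  then have "outer K (N v) v \<noteq> {}" using d D_pos_iff[of K v] by linarith
  then show ?thesis using arg_max_finite[OF finite_outer] False by (auto simp: M2_def msg2_def)
qed (auto simp: M2_def msg2_def)

lemma M_outside:
  assumes "v \<notin> V"
  shows "M1 K v = []" "M2 K v = []"
proof -
  have "outer K (N v) v = {}" using D_outside[OF assms] D_pos_iff[of K v] by auto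
  then show "M1 K v = []" "M2 K v = []" using M1_subset[of K v] M2_subset[of K v] by auto
qed

lemma step_mono: "K \<subseteq> step K"
  by (auto simp: step_def)

lemma M_subset_N: "set (M1 K v) \<subseteq> N v" "set (M2 K v) \<subseteq> N v"
  using M1_subset M2_subset outer_subset by (meson subset_trans)+

lemma step_subset: "K \<subseteq> E \<Longrightarrow> step K \<subseteq> E"
  using M_subset_N[THEN subsetD] by (auto simp: step_def announced_def N_iff)

lemma phase_edges_Suc: "phase_edges (Suc p) = step (phase_edges p)"
  and phase_edges_0: "phase_edges 0 = {}"
  by (simp_all add: phase_edges_def)

lemma phase_edges_subset: "phase_edges p \<subseteq> E"
  by (induction p) (auto simp: phase_edges_0 phase_edges_Suc dest: step_subset)

lemma step_edge: "w \<in> set (M1 K v) \<Longrightarrow> {v, w} \<in> step K" "w \<in> set (M2 K v) \<Longrightarrow> {v, w} \<in> step K"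
  by (auto simp: step_def announced_def)

lemma cls_subset_V: "K \<subseteq> E \<Longrightarrow> v \<in> V \<Longrightarrow> cls K v \<subseteq> V"
  using edge_V by (intro cls_subset_closed) blast+

section \<open>Nodes of low degree\<close>

lemma low_rep:
  assumes "D K v < d" "w \<in> outer K (N v) v"
  shows "\<exists>y\<in>set (M1 K v). cls K y = cls K w"
proof -
  have "cls K w \<in> cls K ` set (reps K (N v) v)"
    unfolding reps(2)[OF finite_N] using assms(2) by (rule imageI)
  moreover have "M1 K v = reps K (N v) v" using assms(1) by (simp add: M1_def msg1_def)
  ultimately show ?thesis by auto
qed

lemma low_announces:
  assumes "D K v < d" "w \<in> N v"
  shows "w \<in> cls (step K) v"
proof (cases "w \<in> outer K (N v) v")
  case True
  then obtain y where y: "y \<in> set (M1 K v)" "cls K y = cls K w"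
    using low_rep[OF assms(1)] by blast
  have "y \<in> cls (step K) v" using step_edge(1)[OF y(1)] cls_edge by blast
  moreover have "w \<in> cls (step K) y"
    using y(2) cls_mono[OF step_mono] cls_eq_iff by blast
  ultimately show ?thesis using cls_eq_iff by blast
next
  case False
  then have "w \<in> cls K v" using assms(2) by (simp add: outer_def cls_eq_iff)
  then show ?thesis using cls_mono[OF step_mono] by blast
qed

text \<open>This is why a node sends a long list at most once: afterwards it has no neighbour
  outside its component.\<close>

lemma low_done: "D K v < d \<Longrightarrow> D (step K) v = 0"
  using low_announces D_pos_iff[of "step K" v] by (auto simp: outer_def cls_eq_iff)

lemma D_zero_mono: "D K v = 0 \<Longrightarrow> D (step K) v = 0"
  using low_done d by simp

subsection \<open>Growth of the components\<close>

definition edge_closed where "edge_closed S \<longleftrightarrow> (\<forall>x\<in>S. N x \<subseteq> S)"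

context
  fixes K assumes KE: "K \<subseteq> E"
begin

abbreviation "kk \<equiv> key n K (D K)"
abbreviation "pr \<equiv> prio n (D K)"
abbreviation "sc \<equiv> score n K (D K) (M1 K)"

section \<open>Priorities and keys\<close>

lemma finite_cls: "v \<in> V \<Longrightarrow> finite (cls K v)"
  using cls_subset_V[OF KE] finite_subset by blast

lemma prio_inj: "u \<in> V \<Longrightarrow> v \<in> V \<Longrightarrow> pr u = pr v \<Longrightarrow> u = v"
proof -
  assume "u \<in> V" "v \<in> V" "pr u = pr v"
  then have "(D K u * (n + 1) + u) mod (n + 1) = (D K v * (n + 1) + v) mod (n + 1)"
    by (simp only: prio_def)
  with \<open>u \<in> V\<close> \<open>v \<in> V\<close> show "u = v"
    by (simp only: mod_mult_self3 atLeastAtMost_iff) simp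
qed

text \<open>The tie-breaking summand of \<open>v\<close> is at most \<open>n\<close>, too small to
  outweigh a difference of one in degree.\<close>

lemma prio_D_le:
  assumes "v \<in> V" "pr u \<le> pr v"
  shows "D K u \<le> D K v"
proof (rule ccontr)
  assume "\<not> D K u \<le> D K v"
  then have "(D K v + 1) * (n + 1) \<le> D K u * (n + 1)" by (intro mult_le_mono1) simp
  then show False using assms by (simp add: prio_def)
qed

lemma key_ex: "v \<in> V \<Longrightarrow> \<exists>u\<in>cls K v. kk v = pr u"
  using Max_in[of "pr ` cls K v"] finite_cls cls_refl unfolding key_def by blast

text \<open>A key is the priority of some node of the component, and that priority identifies the
  node.\<close>

lemma key_inj:
  assumes "u \<in> V" "v \<in> V" "kk u = kk v"
  shows "cls K u = cls K v"
proof -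
  obtain a b where ab: "a \<in> cls K u" "b \<in> cls K v" "kk u = pr a" "kk v = pr b"
    using key_ex assms by meson
  then have "a = b" using prio_inj assms cls_subset_V[OF KE] by (metis subsetD)
  then show ?thesis using ab cls_eq_iff by metis
qed

text \<open>A low-degree \<open>w\<close> announces all adjacent components, that of
  \<open>v\<close> included; a high-degree \<open>w\<close> announces the best one, which is at
  least as good.\<close>

lemma score_attained:
  assumes "w \<in> V" "v \<in> outer K (N w) w"
  shows "\<exists>x\<in>set (M1 K w). kk x = sc w \<and> kk v \<le> kk x"
proof -
  have "\<exists>y\<in>set (M1 K w). kk v \<le> kk y"
  proof (cases "D K w < d")
    case True
    then obtain y where "y \<in> set (M1 K w)" "cls K y = cls K v"
      using low_rep assms(2) by blast
    moreover from this have "kk v = kk y" by (simp add: key_def)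
    ultimately show ?thesis by auto
  next
    case False
    then show ?thesis
      using arg_max_finite(2)[OF finite_outer assms(2)] by (auto simp: M1_def msg1_def)
  qed
  then obtain y where y: "y \<in> set (M1 K w)" "kk v \<le> kk y" by blast
  then have "sc w \<in> kk ` set (M1 K w)" "kk y \<le> sc w"
    unfolding score_def by (auto intro!: Max_in)
  with y show ?thesis using le_trans by auto
qed

text \<open>With \<open>s\<close> the third-round choice of \<open>l\<close>, the chain
  \<open>kk l \<le> sc w \<le> sc s \<le> kk l\<close> collapses: \<open>w\<close> sees
  \<open>l\<close>, \<open>s\<close> has the largest score, and the best component announced by
  \<open>s\<close> is merged with \<open>l\<close>. As keys are injective, \<open>w\<close>
  announced an edge into the old component of \<open>l\<close>.\<close>

lemma leader_absorbs:
  assumes l: "l \<in> V" "d \<le> D K l" and mx: "\<And>x. x \<in> cls (step K) l \<Longrightarrow> pr x \<le> pr l"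
    and w: "w \<in> outer K (N l) l"
  shows "w \<in> cls (step K) l"
proof -
  have V: "cls (step K) l \<subseteq> V" using cls_subset_V step_subset KE l by blast
  have sub: "cls K x \<subseteq> cls (step K) l" if "x \<in> cls (step K) l" for x
    using that cls_mono[OF step_mono] cls_eq_iff by blast
  have mxk: "kk x \<le> kk l" if "x \<in> cls (step K) l" for x
  proof -
    obtain u where "u \<in> cls K x" "kk x = pr u" using key_ex V \<open>x \<in> cls (step K) l\<close> by blast
    then have "kk x \<le> pr l" using mx sub[OF that] by auto
    also have "\<dots> \<le> kk l" unfolding key_def using finite_cls[OF l(1)] by (intro Max_ge) auto
    finally show ?thesis .
  qed
  define s where "s = arg_max sc (\<lambda>w. w \<in> outer K (N l) l)"
  have s: "s \<in> outer K (N l) l" "sc w \<le> sc s"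
    using arg_max_finite[OF finite_outer w, of sc] by (auto simp: s_def)
  have "s \<in> set (M2 K l)" using l(2) by (simp add: M2_def msg2_def s_def)
  then have s_in: "s \<in> cls (step K) l" using step_edge(2) cls_edge by blast
  have wV: "w \<in> V" using w outer_subset N_subset by blast
  obtain x where x: "x \<in> set (M1 K w)" "kk x = sc w" "kk l \<le> kk x"
    using score_attained[OF wV outer_sym[OF w]] by blast
  obtain y where y: "y \<in> set (M1 K s)" "kk y = sc s"
    using score_attained[OF _ outer_sym[OF s(1)]] s_in V by blast
  have "y \<in> cls (step K) l" using step_edge(1)[OF y(1)] s_in cls_edge cls_eq_iff by blast
  then have "kk x = kk l" using mxk y(2) x s(2) by fastforce
  moreover have "x \<in> V" using x(1) M1_subset outer_subset N_subset by blast
  ultimately have "cls K x = cls K l" using key_inj l(1) by blast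
  then have "x \<in> cls (step K) l" using sub[OF cls_refl] cls_refl by blast
  moreover have "x \<in> cls (step K) w" using step_edge(1)[OF x(1)] cls_edge by blast
  ultimately show ?thesis using cls_eq_iff by metis
qed

text \<open>The at least \<open>d\<close> old components adjacent to the top node \<open>l\<close>
  are disjoint and all merged; none was finished, so each contributes \<open>m\<close>
  nodes.\<close>

lemma step_growth:
  assumes IH: "\<And>v. v \<in> V \<Longrightarrow> edge_closed (cls K v) \<or> m \<le> card (cls K v)" and v: "v \<in> V"
  shows "edge_closed (cls (step K) v) \<or> d * m \<le> card (cls (step K) v)"
proof -
  let ?C = "cls (step K) v"
  have V: "?C \<subseteq> V" using cls_subset_V step_subset KE v by blast
  then have fin: "finite ?C" using finite_subset by blast
  obtain l where l: "l \<in> ?C" and mx: "\<And>x. x \<in> ?C \<Longrightarrow> pr x \<le> pr l"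
    using arg_max_finite[OF fin, of _ pr] cls_refl by metis
  have lV: "l \<in> V" and Cl: "cls (step K) l = ?C" using l V cls_eq_iff by blast+
  show ?thesis
  proof (cases "D K l < d")
    case True
    have "D K x < d" if "x \<in> ?C" for x
      using prio_D_le[OF lV mx[OF that]] True by simp
    then have "N x \<subseteq> ?C" if "x \<in> ?C" for x
      using low_announces that cls_eq_iff by blast
    then show ?thesis by (simp add: edge_closed_def)
  next
    case False
    let ?X = "cls K ` outer K (N l) l"
    have out: "w \<in> ?C" if "w \<in> outer K (N l) l" for w
      using leader_absorbs[of l w] that lV False mx Cl by simp
    have sub: "S \<subseteq> ?C" if "S \<in> ?X" for S
      using that out cls_mono[OF step_mono] cls_eq_iff by blast
    have big: "m \<le> card S" if S: "S \<in> ?X" for S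
    proof -
      obtain w where w: "w \<in> outer K (N l) l" "S = cls K w" using S by blast
      \<comment> \<open>The edge from \<open>w\<close> to \<open>l\<close> leaves
        \<open>cls K w\<close>, which rules out the first alternative of \<open>IH\<close>.\<close>
      have "l \<in> N w" "l \<notin> cls K w"
        using outer_sym[OF w(1)] by (auto simp: outer_def cls_eq_iff)
      then have "\<not> edge_closed (cls K w)" unfolding edge_closed_def using cls_refl by blast
      then show ?thesis using IH w out V by blast
    qed
    have "card ?X * m \<le> (\<Sum>S\<in>?X. card S)"
      using sum_mono[of ?X "\<lambda>_. m" card] big by simp
    also have "\<dots> = card (\<Union>?X)"
    proof (rule card_Union_disjoint[symmetric])
      show "pairwise disjnt ?X"
        by (auto simp: pairwise_def disjnt_def) (metis cls_eq_iff)+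
      show "finite S" if "S \<in> ?X" for S using sub[OF that] fin finite_subset by blast
    qed
    also have "\<dots> \<le> card ?C" using sub fin by (intro card_mono) auto
    finally have "card ?X * m \<le> card ?C" .
    moreover have "d * m \<le> card ?X * m" using False by (simp add: D_def deg_def)
    ultimately show ?thesis by linarith
  qed
qed

end

lemma phase_edges_growth:
  "v \<in> V \<Longrightarrow> edge_closed (cls (phase_edges p) v) \<or> d ^ p \<le> card (cls (phase_edges p) v)"
proof (induction p arbitrary: v)
  case 0
  have "0 < card (cls (phase_edges 0) v)"
    using finite_cls[OF phase_edges_subset 0] cls_refl by (metis card_gt_0_iff empty_iff)
  then show ?case by simp
next
  case (Suc p)
  then show ?case using step_growth[OF phase_edges_subset, of p "d ^ p"] by (simp add: phase_edges_Suc)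
qed

text \<open>No component has more than \<open>n\<close> nodes, so the size alternative of the growth
  lemma fails and all components are closed under the edges of \<open>E\<close>.\<close>

lemma phase_edges_final:
  assumes "n < d ^ p" "v \<in> V"
  shows "cls (phase_edges p) v = cls E v"
proof
  have "card (cls (phase_edges p) v) \<le> n"
    using card_mono[OF _ cls_subset_V[OF phase_edges_subset assms(2)]] by simp
  then have "edge_closed (cls (phase_edges p) v)"
    using phase_edges_growth[OF assms(2), of p] assms(1) by linarith
  then have "y \<in> cls (phase_edges p) v" if "x \<in> cls (phase_edges p) v" "{x, y} \<in> E" for x y
    using that N_iff unfolding edge_closed_def by blast
  then show "cls E v \<subseteq> cls (phase_edges p) v" by (intro cls_subset_closed cls_refl)
qed (rule cls_mono[OF phase_edges_subset])

subsection \<open>The execution\<close>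

abbreviation "R \<equiv> run (conn_send n d) n E"

lemma known_append:
  "known (\<tau> @ [m]) = known \<tau> \<union> (if length \<tau> mod 3 = 0 then {} else announced m)"
proof -
  have "{i. i < length (\<tau> @ [m]) \<and> i mod 3 \<noteq> 0} =
      {i. i < length \<tau> \<and> i mod 3 \<noteq> 0} \<union> (if length \<tau> mod 3 = 0 then {} else {length \<tau>})"
    by (auto simp: less_Suc_eq)
  then show ?thesis unfolding known_def by (simp add: nth_append)
qed

text \<open>Assuming \<open>kn\<close> allows its use inside the induction that proves
  \<open>known_run\<close>; \<open>run_phase\<close> then discharges the assumption.\<close>

lemma run_phase_step:
  fixes p
  defines "m0 \<equiv> \<lambda>v. if v \<in> V then [D (phase_edges p) v] else []"
  assumes kn: "known (R (3 * p)) = phase_edges p"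
  shows "R (3 * p + 1) = R (3 * p) @ [m0]"
    "R (3 * p + 2) = R (3 * p) @ [m0, M1 (phase_edges p)]"
    "R (3 * p + 3) = R (3 * p) @ [m0, M1 (phase_edges p), M2 (phase_edges p)]"
    "conn_send n d v (N v) (R (3 * p)) = [D (phase_edges p) v]"
    "conn_send n d v (N v) (R (3 * p + 1)) = M1 (phase_edges p) v"
    "conn_send n d v (N v) (R (3 * p + 2)) = M2 (phase_edges p) v"
proof -
  have m0: "(\<lambda>u. sum_list (m0 u)) = D (phase_edges p)"
    by (auto simp: m0_def fun_eq_iff D_outside)
  have s0: "conn_send n d v (N v) (R (3 * p)) = [D (phase_edges p) v]" for v
    by (simp add: conn_send_def kn D_def Let_def)
  show R1: "R (3 * p + 1) = R (3 * p) @ [m0]"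
    by (auto simp: s0 m0_def fun_eq_iff)
  have s1: "conn_send n d v (N v) (R (3 * p + 1)) = M1 (phase_edges p) v" for v
  proof -
    have "(3 * p + 1) div 3 = p" "(3 * p + 1) mod 3 = 1" by simp_all
    then show ?thesis unfolding R1
      by (simp add: conn_send_def kn Let_def M1_def nth_append m0)
  qed
  have "3 * p + 2 = Suc (3 * p + 1)" by simp
  then have "R (3 * p + 2) = R (3 * p + 1) @
      [\<lambda>v. if v \<in> V then conn_send n d v (N v) (R (3 * p + 1)) else []]"
    by (simp only: run.simps(2))
  also have "(\<lambda>v. if v \<in> V then conn_send n d v (N v) (R (3 * p + 1)) else []) = M1 (phase_edges p)"
    by (simp only: s1) (use M_outside in \<open>auto simp: fun_eq_iff\<close>)
  finally show R2: "R (3 * p + 2) = R (3 * p) @ [m0, M1 (phase_edges p)]"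
    unfolding R1 by simp
  have s2: "conn_send n d v (N v) (R (3 * p + 2)) = M2 (phase_edges p) v" for v
  proof -
    have "(3 * p + 2) div 3 = p" "(3 * p + 2) mod 3 = 2" by presburger+
    then show ?thesis unfolding R2
      by (simp add: conn_send_def kn Let_def M2_def nth_append m0)
  qed
  have "3 * p + 3 = Suc (3 * p + 2)" by simp
  then have "R (3 * p + 3) = R (3 * p + 2) @
      [\<lambda>v. if v \<in> V then conn_send n d v (N v) (R (3 * p + 2)) else []]"
    by (simp only: run.simps(2))
  also have "(\<lambda>v. if v \<in> V then conn_send n d v (N v) (R (3 * p + 2)) else []) = M2 (phase_edges p)"
    by (simp only: s2) (use M_outside in \<open>auto simp: fun_eq_iff\<close>)
  finally show "R (3 * p + 3) = R (3 * p) @ [m0, M1 (phase_edges p), M2 (phase_edges p)]"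
    unfolding R2 by simp
  show "conn_send n d v (N v) (R (3 * p)) = [D (phase_edges p) v]"
    "conn_send n d v (N v) (R (3 * p + 1)) = M1 (phase_edges p) v"
    "conn_send n d v (N v) (R (3 * p + 2)) = M2 (phase_edges p) v"
    by (fact s0 s1 s2)+
qed

lemma known_run: "known (R (3 * p)) = phase_edges p"
proof (induction p)
  case 0
  then show ?case by (simp add: known_def phase_edges_0)
next
  case (Suc p)
  let ?m0 = "\<lambda>v. if v \<in> V then [D (phase_edges p) v] else []"
  have "R (3 * Suc p) = ((R (3 * p) @ [?m0]) @ [M1 (phase_edges p)]) @ [M2 (phase_edges p)]"
    using run_phase_step(3)[OF Suc] by (simp add: add.commute)
  moreover have "Suc (3 * p) mod 3 = 1" "Suc (Suc (3 * p)) mod 3 = 2" by presburger+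
  ultimately have "known (R (3 * Suc p)) =
      phase_edges p \<union> announced (M1 (phase_edges p)) \<union> announced (M2 (phase_edges p))"
    by (simp only: known_append) (simp add: Suc)
  then show ?case by (simp add: phase_edges_Suc step_def)
qed

lemmas run_phase = run_phase_step(4-6)[OF known_run]

lemma round_cases:
  fixes t :: nat
  obtains p where "t = 3 * p" | p where "t = 3 * p + 1" | p where "t = 3 * p + 2"
proof -
  have "t = 3 * (t div 3) + t mod 3" "t mod 3 < 3" by simp_all
  then show thesis using that by (metis One_nat_def add_0_right less_2_cases numeral_2_eq_2
    numeral_3_eq_3 less_Suc_eq less_one)
qed

lemma send_values: "set (conn_send n d v (N v) (R t)) \<subseteq> {..n}"
proof (cases rule: round_cases[of t])
  case (1 p) then show ?thesis by (simp add: run_phase D_le)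
next
  case (2 p)
  have "set (M1 (phase_edges p) v) \<subseteq> V" using M_subset_N(1)[of "phase_edges p" v] N_subset[of v] by blast
  then show ?thesis unfolding 2 run_phase by auto
next
  case (3 p)
  have "set (M2 (phase_edges p) v) \<subseteq> V" using M_subset_N(2)[of "phase_edges p" v] N_subset[of v] by blast
  then show ?thesis unfolding 3 run_phase by auto
qed

section \<open>Number of bits sent\<close>

definition bulk where "bulk K v = (if D K v < d then D K v else 0)"

lemma length_M1: "length (M1 K v) \<le> 1 + bulk K v"
  using reps(3)[OF finite_N] by (simp add: M1_def msg1_def bulk_def D_def)

lemma length_M1_le_d: "length (M1 K v) \<le> d"
  using reps(3)[OF finite_N, of K v v] d by (auto simp: M1_def msg1_def D_def)

lemma length_M2: "length (M2 K v) \<le> 1"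
  by (simp add: M2_def msg2_def)

lemma send_length: "length (conn_send n d v (N v) (R t)) \<le> d"
proof (cases rule: round_cases[of t])
  case 1 then show ?thesis using d by (simp add: run_phase)
next
  case 2 then show ?thesis using length_M1_le_d by (simp only: run_phase)
next
  case 3 then show ?thesis using length_M2 d by (simp only: run_phase) (meson le_trans numeral_le_one_iff
    one_le_numeral)
qed

text \<open>The second conjunct strengthens the induction: while the degree is still positive,
  nothing has been paid. The single payment is less than \<open>d\<close>, and the degree is 0 from
  then on.\<close>

lemma sum_bulk:
  "(\<Sum>p<P. bulk (phase_edges p) v) \<le> d \<and>
    (0 < D (phase_edges P) v \<longrightarrow> (\<Sum>p<P. bulk (phase_edges p) v) = 0)"
proof (induction P)
  case (Suc P)
  consider "D (phase_edges P) v = 0" | "0 < D (phase_edges P) v" "D (phase_edges P) v < d" | "d \<le> D (phase_edges P) v"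
    by linarith
  then show ?case
  proof cases
    case 1 then show ?thesis using Suc D_zero_mono by (simp add: bulk_def phase_edges_Suc)
  next
    case 2 then show ?thesis using Suc low_done by (simp add: bulk_def phase_edges_Suc)
  next
    case 3 then show ?thesis using Suc d by (simp add: bulk_def)
  qed
qed simp

text \<open>Each phase costs at most three numbers (a degree and two announcements) besides
  \<open>bulk\<close>.\<close>

lemma send_total: "(\<Sum>t<3 * P. length (conn_send n d v (N v) (R t))) \<le> 3 * P + d"
proof -
  have "(\<Sum>t<3 * P. length (conn_send n d v (N v) (R t))) \<le> (\<Sum>p<P. 3 + bulk (phase_edges p) v)"
  proof (induction P)
    case (Suc P)
    have "sum g {..<3 * Suc P} = sum g {..<3 * P} + g (3 * P) + g (3 * P + 1) + g (3 * P + 2)"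
      for g :: "nat \<Rightarrow> nat"
      by (simp add: numeral_3_eq_3)
    then have "(\<Sum>t<3 * Suc P. length (conn_send n d v (N v) (R t))) =
        (\<Sum>t<3 * P. length (conn_send n d v (N v) (R t))) +
        1 + length (M1 (phase_edges P) v) + length (M2 (phase_edges P) v)"
      by (simp only: run_phase) simp
    then show ?case using Suc length_M1[of "phase_edges P" v] length_M2[of "phase_edges P" v] by simp
  qed simp
  also have "\<dots> \<le> 3 * P + d" using sum_bulk[of v P] by (simp add: sum.distrib)
  finally show ?thesis .
qed

lemma result_correct:
  assumes "n < d ^ p"
  shows "spanning_forest V E (conn_result (R (3 * p)))"
proof -
  let ?F = "conn_result (R (3 * p))"
  have "finite (phase_edges p)" using phase_edges_subset finite_E finite_subset by blast
  from someI_ex[OF exists_forest[OF this]]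
  have F: "?F \<subseteq> phase_edges p" "\<nexists>vs. is_cycle ?F vs" "\<forall>v. cls ?F v = cls (phase_edges p) v"
    by (simp_all add: conn_result_def known_run)
  then have "components V ?F = components V E"
    using phase_edges_final[OF assms] by (intro components_cong) simp
  with F show ?thesis
    using subset_trans[OF F(1) phase_edges_subset] by (simp add: spanning_forest_def)
qed

end

section \<open>Choice of the constants\<close>

theorem corollary3:
  shows "\<exists>c\<^sub>b c\<^sub>r c\<^sub>s :: real. 0 < c\<^sub>b \<and> 0 < c\<^sub>r \<and> 0 < c\<^sub>s \<and>
    (\<forall>n d :: nat. 2 \<le> d \<and> d \<le> n \<longrightarrow>
      connectivity_solvable n
        (c\<^sub>b * (real d * log 2 (real n)))
        (c\<^sub>r * log (real d) (real n))
        (c\<^sub>s * (log 2 (real n) * (real d + log 2 (real n) / log 2 (real d)))))"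
proof -
  have "connectivity_solvable n (2 * (real d * log 2 (real n))) (6 * log (real d) (real n))
      (12 * (log 2 (real n) * (real d + log 2 (real n) / log 2 (real d))))"
    if d: "2 \<le> d" and n: "d \<le> n" for n d :: nat
  proof -
    \<comment> \<open>\<open>P\<close> phases suffice since \<open>n < d ^ P\<close>, and
      \<open>k\<close> bits hold any number up to \<open>n\<close>.\<close>
    define P k where "P = floorlog d n" and "k = floorlog 2 n"
    have floorlog: "n < b ^ floorlog b n" "real (floorlog b n) \<le> 2 * log b n" "0 < floorlog b n"
      if b: "2 \<le> b" "b \<le> n" for b
    proof -
      show "n < b ^ floorlog b n" using b by (simp add: floorlog_bounds)
      show "0 < floorlog b n" using b by (simp add: floorlog_def)
      \<comment> \<open>As \<open>b \<le> n\<close>, the rounding error 1 is absorbed by doubling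
        the logarithm; with three rounds per phase this gives the constants 2 and 6.\<close>
      have "1 \<le> log b n" using b by simp
      moreover have "real (floorlog b n) \<le> log b n + 1"
        using b of_nat_floor[of "log b n"] by (simp add: floorlog_def)
      ultimately show "real (floorlog b n) \<le> 2 * log b n" by simp
    qed
    note P = floorlog[OF d n, folded P_def]
    note k = floorlog[of 2, folded k_def]
    have log_eq: "log d n = log 2 n / log 2 d"
      using d by (simp add: log_def)
    show ?thesis
    proof (rule connectivity_solvable_run[where T = "3 * P" and f = "conn_send n d"
          and g = conn_result and L = d and S = "3 * P + d" and k = k])
      have cg: "clique_graph n d E" if "ugraph {1..n} E" for E
        using d that by (simp add: clique_graph_def)
      show "n < 2 ^ k" "0 < k" using k d n by simp_all
      show "real (3 * P) \<le> 6 * log d n" using P by simp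
      show "real (k * d) \<le> 2 * (d * log 2 n)"
        using mult_right_mono[OF k(2), of "real d"] d n by (simp add: mult_ac)
      have "real (k * (3 * P + d)) = real k * (3 * real P + d)" by simp
      \<comment> \<open>The factor 6 covers \<open>3 * P \<le> 6 * log d n\<close> and also
        \<open>d\<close>; with the 2 from \<open>k\<close> it makes 12.\<close>
      also have "\<dots> \<le> (2 * log 2 n) * (6 * (d + log d n))"
        using k(2) P(2) d n by (intro mult_mono) auto
      also have "\<dots> = 12 * (log 2 n * (d + log d n))" by simp
      finally show "real (k * (3 * P + d)) \<le> 12 * (log 2 n * (d + log 2 n / log 2 d))"
        by (simp only: log_eq)
    qed (use clique_graph.send_values clique_graph.send_length clique_graph.send_total
        clique_graph.result_correct P d in \<open>auto simp: clique_graph_def\<close>)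
  qed
  then show ?thesis
    by (intro exI[of _ 2] exI[of _ 6] exI[of _ 12]) auto
qed

end
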